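(* Let $B_1(0)$ be the open unit ball of $\mathbb{R}^N$ and let $f$ be a Lipschitz continuous function. Assume that $u\in C^{1,1}_{loc}(B_1(0))\cap C(\overline{B_1(0)})$ is a positive solution of $$\begin{cases}(-\Delta+m^2)^s u(x)=f(u(x)), & x\in B_1(0),\\ u(x)>0, & x\in B_1(0),\\ u(x)=0, & x\in\mathbb{R}^N\setminus B_1(0).\end{cases}$$ Then $u$ is radially symmetric and strictly monotone decreasing with respect to the origin $0$.
   Context: Let $N\ge 1$ be an integer, $0<s<1$, $m>0$. $K_\nu$ is the modified Bessel function of the second kind of order $\nu$, $K_\nu(r)=\int_0^\infty e^{-r\cosh t}\cosh(\nu t)\,dt$ for $r>0$. The operator $(-\Delta+m^2)^s$ is defined by $$(-\Delta+m^2)^s u(x)=c_{N,s}m^{\frac N2+s}\,\mathrm{P.V.}\int_{\mathbb{R}^N}\frac{u(x)-u(y)}{|x-y|^{\frac N2+s}}K_{\frac N2+s}(m|x-y|)\,dy+m^{2s}u(x),\qquad c_{N,s}=2^{1-\frac N2+s}\pi^{-\frac N2}\frac{s(1-s)}{\Gamma(2-s)},$$ where P.V. denotes the Cauchy principal value. $C^{1,1}_{loc}$ denotes $C^1$ functions with locally Lipschitz gradient. Equations are understood pointwise. *)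

theory Defs
  imports "HOL-Analysis.Analysis"
begin

definition bessel_K :: "real \<Rightarrow> real \<Rightarrow> real" where
  "bessel_K \<nu> r = (LINT t:{0..}|lborel. exp (- r * cosh t) * cosh (\<nu> * t))"

text \<open>Cauchy principal value at \<open>x\<close>. It is a relation rather than a function, so that
  existence of the truncated integrals and of their limit is part of the assertion.\<close>

definition has_pv_integral :: "('a::euclidean_space \<Rightarrow> real) \<Rightarrow> real \<Rightarrow> 'a \<Rightarrow> bool" where
  "has_pv_integral g I x \<longleftrightarrow>
     (\<forall>\<epsilon>>0. set_integrable lborel (- ball x \<epsilon>) g) \<and>
     ((\<lambda>\<epsilon>. LINT y:(- ball x \<epsilon>)|lborel. g y) \<longlongrightarrow> I) (at_right 0)"

definition c_Ns :: "nat \<Rightarrow> real \<Rightarrow> real" where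
  "c_Ns N s = 2 powr (1 - real N / 2 + s) * pi powr (- real N / 2) * (s * (1 - s) / Gamma (2 - s))"

text \<open>\<open>has_frac_op m s u x v\<close> means that \<open>(-\<Delta> + m\<^sup>2)\<^sup>s u\<close> is defined at \<open>x\<close>
  and has the value \<open>v\<close> there; the dimension \<open>N\<close> is \<open>DIM('a)\<close>.\<close>

definition has_frac_op ::
    "real \<Rightarrow> real \<Rightarrow> ('a::euclidean_space \<Rightarrow> real) \<Rightarrow> 'a \<Rightarrow> real \<Rightarrow> bool" where
  "has_frac_op m s u x v \<longleftrightarrow>
     (let N = DIM('a); \<alpha> = real N / 2 + s in
      \<exists>I. has_pv_integral
            (\<lambda>y. (u x - u y) / norm (x - y) powr \<alpha> * bessel_K \<alpha> (m * norm (x - y))) I x \<and>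
          v = c_Ns N s * m powr \<alpha> * I + m powr (2 * s) * u x)"

definition C11_loc_on :: "'a::euclidean_space set \<Rightarrow> ('a \<Rightarrow> real) \<Rightarrow> bool" where
  "C11_loc_on S u \<longleftrightarrow>
     (\<exists>Du. (\<forall>x\<in>S. GDERIV u x :> Du x) \<and>
           (\<forall>x\<in>S. \<exists>r>0. \<exists>L. L-lipschitz_on (ball x r \<inter> S) Du))"

end

theory Submission
  imports Defs
begin

text \<open>
The proof is the method of moving planes. For a unit vector \<open>e\<close> and \<open>0 < l < 1\<close> compare \<open>u\<close> with its
mirror image in the hyperplane \<open>{x. x \<bullet> e = l}\<close>: the gap \<open>u (reflect e l x) - u x\<close> is
antisymmetric, and it solves the linearised equation because the kernel depends only on distances and
reflections preserve Lebesgue measure. If the gap is nonnegative on the far side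
\<open>{x. l < x \<bullet> e}\<close> for all \<open>e\<close> and \<open>l\<close>, letting \<open>l\<close> tend to \<open>0\<close> for both \<open>e\<close> and \<open>- e\<close> makes \<open>u\<close>
symmetric in every hyperplane through the origin, hence radial; if the gap is positive at
points of the closed ball on that side, \<open>u\<close> is strictly decreasing along each radius.

The operator is nonlocal, but its kernel is radial and strictly decreasing, so a point is coupled more
strongly to a point on its own side than to the mirror image of that point. This bounds the
principal value at a minimum point of an antisymmetric function from above
(\<open>principal_value_le\<close>), with two consequences. Close to the hyperplane the coupling to the other side
is arbitrarily strong, because the kernel is not integrable at the origin; it then
dominates the Lipschitz constant of \<open>f\<close>, and so a negative minimum of the gap keeps a uniform distance
from the hyperplane (\<open>narrow_region\<close>). And a nonnegative gap is positive inside the ball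
(\<open>strong_maximum_principle\<close>). Compactness turns these two facts into nonnegativity for all hyperplanes
(\<open>gap_nonneg\<close>).

The Bessel function enters through its positivity, its monotonicity and its lower bound by a
multiple of \<open>r powr (- \<nu>)\<close> near \<open>0\<close>.\<close>

section \<open>Orthogonal invariance of Lebesgue measure\<close>

lemma nn_integral_lborel_translate:
  fixes c :: "'a::euclidean_space"
  assumes [measurable]: "g \<in> borel_measurable borel"
  shows "(\<integral>\<^sup>+x. g (c + x) \<partial>lborel) = (\<integral>\<^sup>+x. g x \<partial>lborel)"
proof -
  have "(\<integral>\<^sup>+x. g x \<partial>lborel) = (\<integral>\<^sup>+x. g x \<partial>distr lborel borel ((+) c))"
    by (simp add: lborel_distr_plus)
  also have "\<dots> = (\<integral>\<^sup>+x. g (c + x) \<partial>lborel)"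
    by (subst nn_integral_distr) auto
  finally show ?thesis by simp
qed

lemma orthogonal_transformation_borel:
  fixes T :: "'a::euclidean_space \<Rightarrow> 'a"
  assumes "orthogonal_transformation T"
  shows "T \<in> borel_measurable borel"
  using orthogonal_transformation_linear[OF assms]
  by (intro borel_measurable_continuous_onI linear_continuous_on)
     (simp add: linear_conv_bounded_linear)

text \<open>The uniqueness argument for translation-invariant measures: integrate
\<open>1_A (T x) 1_B (T x + y)\<close> over all pairs \<open>(x, y)\<close>. Translating in \<open>y\<close> separates the two factors
one way, translating in \<open>x\<close> by a preimage of \<open>y\<close> separates them the other way.\<close>

lemma emeasure_orthogonal_swap:
  fixes T :: "'a::euclidean_space \<Rightarrow> 'a"
  assumes T: "orthogonal_transformation T"
    and [measurable]: "A \<in> sets borel" "B \<in> sets borel"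
  shows "emeasure lborel (T -` A) * emeasure lborel B
       = emeasure lborel (T -` B) * emeasure lborel (uminus -` A)"
proof -
  have lin: "linear T" using T by (rule orthogonal_transformation_linear)
  have [measurable]: "T \<in> borel_measurable borel"
    using T by (rule orthogonal_transformation_borel)
  have vim: "T -` S \<in> sets borel" if "S \<in> sets borel" for S
    using measurable_sets[OF \<open>T \<in> borel_measurable borel\<close> that] by simp
  have umin: "uminus -` A \<in> sets (borel::'a measure)"
    using measurable_sets[of uminus borel borel A] by simp
  have "emeasure lborel (T -` A) * emeasure lborel B
      = (\<integral>\<^sup>+x. indicator A (T x) * emeasure lborel B \<partial>lborel)"
    using vim[of A] by (subst nn_integral_multc)
      (auto simp: indicator_vimage[symmetric] comp_def simp flip: nn_integral_indicator)
  also have "\<dots> = (\<integral>\<^sup>+x. \<integral>\<^sup>+y. indicator A (T x) * indicator B (T x + y) \<partial>lborel \<partial>lborel)"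
    by (subst nn_integral_cmult, simp, subst nn_integral_lborel_translate) auto
  also have "\<dots> = (\<integral>\<^sup>+y. \<integral>\<^sup>+x. indicator A (T x) * indicator B (T x + y) \<partial>lborel \<partial>lborel)"
    by (subst lborel_pair.Fubini') auto
  also have "\<dots> = (\<integral>\<^sup>+y. \<integral>\<^sup>+x. indicator A (T x - y) * indicator B (T x) \<partial>lborel \<partial>lborel)"
  proof (rule nn_integral_cong)
    fix y :: 'a
    obtain t where t: "T t = y"
      using orthogonal_transformation_surj[OF T] by (metis surjD)
    have *: "T (x - t) = T x - y" for x
      using lin t by (simp add: linear_diff)
    show "(\<integral>\<^sup>+x. indicator A (T x) * indicator B (T x + y) \<partial>lborel)
        = (\<integral>\<^sup>+x. (indicator A (T x - y) * indicator B (T x) :: ennreal) \<partial>lborel)"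
      using nn_integral_lborel_translate[of "\<lambda>x. indicator A (T x) * indicator B (T x + y)" "- t"]
      by (simp add: *)
  qed
  also have "\<dots> = (\<integral>\<^sup>+x. \<integral>\<^sup>+y. indicator A (T x - y) * indicator B (T x) \<partial>lborel \<partial>lborel)"
    by (subst lborel_pair.Fubini') auto
  also have "\<dots> = (\<integral>\<^sup>+x. indicator B (T x) * emeasure lborel (uminus -` A) \<partial>lborel)"
  proof (rule nn_integral_cong)
    fix x :: 'a
    have "(\<integral>\<^sup>+y. indicator A (T x - y) * indicator B (T x) \<partial>lborel)
        = (\<integral>\<^sup>+y. indicator A (T x - y) \<partial>lborel) * indicator B (T x)"
      by (subst nn_integral_multc) auto
    also have "(\<integral>\<^sup>+y. indicator A (T x - y) \<partial>lborel) = (\<integral>\<^sup>+y. indicator A (- y) \<partial>lborel)"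
      by (subst nn_integral_lborel_translate[of _ "T x", symmetric]) auto
    also have "\<dots> = emeasure lborel (uminus -` A)"
      using umin by (auto simp: indicator_vimage[symmetric] comp_def simp flip: nn_integral_indicator)
    finally show "(\<integral>\<^sup>+y. indicator A (T x - y) * indicator B (T x) \<partial>lborel)
        = indicator B (T x) * emeasure lborel (uminus -` A)" by (simp add: mult.commute)
  qed
  also have "\<dots> = emeasure lborel (T -` B) * emeasure lborel (uminus -` A)"
    using vim[of B] by (subst nn_integral_multc)
      (auto simp: indicator_vimage[symmetric] comp_def simp flip: nn_integral_indicator)
  finally show ?thesis .
qed

text \<open>In the identity above take for \<open>B\<close> the unit ball, which \<open>T\<close> preserves and whose measure is
positive and finite, and compare with the case \<open>T = id\<close>, which disposes of the set \<open>- A\<close>.\<close>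

lemma distr_lborel_orthogonal:
  fixes T :: "'a::euclidean_space \<Rightarrow> 'a"
  assumes T: "orthogonal_transformation T"
  shows "distr lborel borel T = lborel"
proof (rule measure_eqI)
  have [measurable]: "T \<in> borel_measurable borel"
    using T by (rule orthogonal_transformation_borel)
  let ?B = "ball 0 1 :: 'a set"
  have norm: "norm (T x) = norm x" for x
    using T by (simp add: orthogonal_transformation)
  have vB: "T -` ?B = ?B" by (auto simp: norm)
  have B: "emeasure lborel ?B \<noteq> 0" "emeasure lborel ?B \<noteq> \<infinity>"
    using content_ball_gt_0_iff[of "0::'a" 1] emeasure_lborel_ball_finite[of "0::'a" 1]
    by (auto simp: measure_def)
  show "emeasure (distr lborel borel T) A = emeasure lborel A"
    if "A \<in> sets (distr lborel borel T)" for A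
  proof -
    have A: "A \<in> sets borel" using that by simp
    have "emeasure lborel (T -` A) * emeasure lborel ?B = emeasure lborel A * emeasure lborel ?B"
      using emeasure_orthogonal_swap[OF T A, of ?B]
        emeasure_orthogonal_swap[OF orthogonal_transformation_id A, of ?B]
      by (simp add: vB mult.commute)
    hence "emeasure lborel (T -` A) = emeasure lborel A"
      using B by (auto simp: mult.commute[of _ "emeasure lborel ?B"] ennreal_mult_cancel_left)
    thus ?thesis using A by (simp add: emeasure_distr)
  qed
qed auto

section \<open>Reflection in a hyperplane\<close>

text \<open>
For a unit vector \<open>e\<close> this is the mirror image of \<open>x\<close> in the hyperplane \<open>{x. x \<bullet> e = l}\<close>.\<close>

definition reflect :: "'a::euclidean_space \<Rightarrow> real \<Rightarrow> 'a \<Rightarrow> 'a" where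
  "reflect e l x = x + (2 * (l - x \<bullet> e)) *\<^sub>R e"

lemma inner_reflect: "norm e = 1 \<Longrightarrow> reflect e l x \<bullet> e = 2 * l - x \<bullet> e"
  by (simp add: reflect_def algebra_simps flip: power2_norm_eq_inner)

lemma reflect_axis:
  assumes "norm e = 1"
  shows "reflect e l (t *\<^sub>R e) = (2 * l - t) *\<^sub>R e"
proof -
  have "e \<bullet> e = 1" using assms by (simp flip: power2_norm_eq_inner)
  hence "reflect e l (t *\<^sub>R e) = t *\<^sub>R e + (2 * (l - t)) *\<^sub>R e" by (simp add: reflect_def)
  also have "\<dots> = (2 * l - t) *\<^sub>R e" by (simp flip: scaleR_add_left)
  finally show ?thesis .
qed

lemma reflect_reflect: "norm e = 1 \<Longrightarrow> reflect e l (reflect e l x) = x"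
  by (simp add: inner_reflect reflect_def[of e l "reflect e l x"])
     (simp add: reflect_def flip: scaleR_add_left)

text \<open>The correction term has the sign of the product of the two signed distances to the hyperplane.
Two points on the same side are therefore closer to each other than to each other's mirror
images, and a point beyond a hyperplane that misses the origin is reflected towards the origin.\<close>

lemma norm_diff_reflect_sq:
  assumes "norm e = 1"
  shows "(norm (reflect e l x - y))\<^sup>2 = (norm (x - y))\<^sup>2 + 4 * (l - x \<bullet> e) * (l - y \<bullet> e)"
proof -
  have ee: "e \<bullet> e = 1" using assms by (simp flip: power2_norm_eq_inner)
  have "reflect e l x - y = (x - y) + (2 * (l - x \<bullet> e)) *\<^sub>R e"
    by (simp add: reflect_def)
  hence "(norm (reflect e l x - y))\<^sup>2 = (norm (x - y))\<^sup>2
      + 2 * ((x - y) \<bullet> ((2 * (l - x \<bullet> e)) *\<^sub>R e)) + (2 * (l - x \<bullet> e))\<^sup>2"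
    unfolding \<open>reflect e l x - y = _\<close> power2_norm_eq_inner
    by (simp add: inner_add_left inner_add_right ee inner_commute power2_eq_square)
  thus ?thesis by (simp add: inner_diff_left power2_eq_square algebra_simps)
qed

lemma norm_reflect_sq:
  assumes "norm e = 1"
  shows "(norm (reflect e l x))\<^sup>2 = (norm x)\<^sup>2 + 4 * l * (l - x \<bullet> e)"
  using norm_diff_reflect_sq[OF assms, of l x 0] by simp

lemma norm_reflect_diff_reflect:
  assumes "norm e = 1"
  shows "norm (reflect e l x - reflect e l y) = norm (x - y)"
proof -
  have "(norm (reflect e l x - reflect e l y))\<^sup>2 = (norm (x - y))\<^sup>2"
    using norm_diff_reflect_sq[OF assms, of l x "reflect e l y"]
      norm_diff_reflect_sq[OF assms, of l y x]
    by (simp add: inner_reflect[OF assms] norm_minus_commute algebra_simps)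
  thus ?thesis by simp
qed

lemma continuous_on_reflect [continuous_intros]:
  assumes "continuous_on S f" "continuous_on S g"
  shows "continuous_on S (\<lambda>x. reflect e (f x) (g x))"
  unfolding reflect_def by (intro continuous_intros assms)

lemma borel_measurable_reflect [measurable]: "reflect e l \<in> borel_measurable borel"
  by (intro borel_measurable_continuous_onI continuous_intros)

lemma distr_lborel_reflect:
  assumes "norm e = 1"
  shows "distr lborel borel (reflect e l) = lborel"
proof -
  have "linear (reflect e 0)"
    by (rule linearI) (simp_all add: reflect_def algebra_simps)
  hence T: "orthogonal_transformation (reflect e 0)"
    using norm_reflect_sq[OF assms, of 0] by (simp add: orthogonal_transformation)
  have "reflect e l = (+) ((2 * l) *\<^sub>R e) \<circ> reflect e 0"
    by (auto simp: fun_eq_iff reflect_def algebra_simps)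
  hence "distr lborel borel (reflect e l) = distr (distr lborel borel (reflect e 0)) borel ((+) ((2 * l) *\<^sub>R e))"
    by (subst distr_distr) auto
  also have "\<dots> = lborel"
    using distr_lborel_orthogonal[OF T] by (simp add: lborel_distr_plus)
  finally show ?thesis .
qed

lemma distr_lborel_point_reflection:
  "distr lborel borel (\<lambda>y. c - y) = (lborel :: 'a::euclidean_space measure)"
proof -
  have T: "orthogonal_transformation (uminus :: 'a \<Rightarrow> 'a)"
    using orthogonal_transformation_neg[of "\<lambda>x. x"] by simp
  have "(\<lambda>y. c - y) = (+) c \<circ> uminus" by auto
  hence "distr lborel borel (\<lambda>y. c - y) = distr (distr lborel borel uminus) borel ((+) c)"
    by (subst distr_distr) auto
  also have "\<dots> = lborel"
    using distr_lborel_orthogonal[OF T] by (simp add: lborel_distr_plus)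
  finally show ?thesis .
qed

lemma measure_preserving_integrable:
  fixes g :: "'a::euclidean_space \<Rightarrow> real"
  assumes "distr lborel borel T = (lborel :: 'a measure)"
    and [measurable]: "T \<in> borel_measurable borel" "g \<in> borel_measurable borel"
  shows "integrable lborel (\<lambda>x. g (T x)) \<longleftrightarrow> integrable lborel g"
  using integrable_distr_eq[of T lborel borel g] assms(1) by simp

lemma measure_preserving_integral:
  fixes g :: "'a::euclidean_space \<Rightarrow> real"
  assumes "distr lborel borel T = (lborel :: 'a measure)"
    and [measurable]: "T \<in> borel_measurable borel" "g \<in> borel_measurable borel"
  shows "(\<integral>x. g (T x) \<partial>lborel) = (\<integral>x. g x \<partial>lborel)"
  using integral_distr[of T lborel borel g] assms(1) by simp

lemma AE_inner_neq:
  fixes e :: "'a::euclidean_space"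
  assumes "e \<noteq> 0"
  shows "AE y in lborel. y \<bullet> e \<noteq> l"
proof -
  have "negligible {y. e \<bullet> y = l}"
    using assms by (intro negligible_hyperplane) auto
  hence "{y. e \<bullet> y = l} \<in> null_sets lborel"
    by (simp add: negligible_iff_null_sets null_sets_completion_iff closed_hyperplane borel_closed)
  thus ?thesis
    by (rule AE_I') (auto simp: inner_commute)
qed

section \<open>A maximum principle for antisymmetric functions\<close>

locale radial_decreasing_kernel =
  fixes J :: "'a::euclidean_space \<Rightarrow> real"
  assumes J_borel [measurable]: "J \<in> borel_measurable borel"
    and J_pos: "x \<noteq> 0 \<Longrightarrow> 0 < J x"
    and J_less: "x \<noteq> 0 \<Longrightarrow> norm x < norm y \<Longrightarrow> J y < J x"
    and J_radial: "norm x = norm y \<Longrightarrow> J x = J y"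
    and J_integrable: "set_integrable lborel (- ball 0 1) J"
begin

lemma J_le: "x \<noteq> 0 \<Longrightarrow> norm x \<le> norm y \<Longrightarrow> J y \<le> J x"
  using J_less[of x y] J_radial[of x y] by (cases "norm x = norm y") auto

lemma set_integrable_off_ball:
  assumes "0 < \<epsilon>"
  shows "set_integrable lborel (- ball 0 \<epsilon>) J"
proof -
  obtain z :: 'a where z: "norm z = \<epsilon>"
    using vector_choose_size[of \<epsilon>] assms by auto
  hence "z \<noteq> 0" using assms by auto
  have "set_integrable lborel (ball 0 1 - ball 0 \<epsilon>) J"
    unfolding set_integrable_def
  proof (rule integrableI_bounded_set_indicator[where B = "J z"])
    have "emeasure lborel (ball 0 1 - ball 0 \<epsilon> :: 'a set) \<le> emeasure lborel (ball 0 1 :: 'a set)"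
      by (intro emeasure_mono) auto
    also have "\<dots> < \<infinity>" by (rule emeasure_lborel_ball_finite)
    finally show "emeasure lborel (ball 0 1 - ball 0 \<epsilon> :: 'a set) < \<infinity>" .
    have "norm (J x) \<le> J z" if "x \<notin> ball 0 \<epsilon>" for x
    proof -
      have "norm z \<le> norm x" using that z by auto
      moreover have "x \<noteq> 0" using that assms by auto
      ultimately show ?thesis using J_le[of z x] J_pos[of x] \<open>z \<noteq> 0\<close> by simp
    qed
    thus "AE x \<in> ball 0 1 - ball 0 \<epsilon> in lborel. norm (J x) \<le> J z" by auto
  qed auto
  hence "set_integrable lborel (- ball 0 1 \<union> (ball 0 1 - ball 0 \<epsilon>)) J"
    using J_integrable by (intro set_integrable_Un) auto
  thus ?thesis by (rule set_integrable_subset) auto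
qed

text \<open>The kernel mass that a point sees on the other side of a hyperplane at distance \<open>d\<close>. It controls
how strongly antisymmetry forbids a negative minimum at distance \<open>d\<close> from the hyperplane.\<close>

definition halfspace_mass :: "'a \<Rightarrow> real \<Rightarrow> real" where
  "halfspace_mass e d = (LINT z:{z. d < z \<bullet> e}|lborel. J z)"

lemma inner_le_norm_unit: "norm e = 1 \<Longrightarrow> z \<bullet> e \<le> norm z"
  using norm_cauchy_schwarz[of z e] by simp

lemma halfspace_integrable:
  assumes "norm e = 1" "0 < d"
  shows "set_integrable lborel {z. d < z \<bullet> e} J"
  using set_integrable_off_ball[OF \<open>0 < d\<close>]
proof (rule set_integrable_subset)
  show "{z. d < z \<bullet> e} \<subseteq> - ball 0 d"
  proof
    fix z assume "z \<in> {z. d < z \<bullet> e}"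
    thus "z \<in> - ball 0 d" using inner_le_norm_unit[OF assms(1), of z] by simp
  qed
qed auto

lemma halfspace_mass_antimono:
  assumes e: "norm e = 1" and d: "0 < d" "d \<le> d'"
  shows "halfspace_mass e d' \<le> halfspace_mass e d"
  unfolding halfspace_mass_def set_lebesgue_integral_def
proof (rule integral_mono)
  fix z
  show "indicator {z. d' < z \<bullet> e} z *\<^sub>R J z \<le> indicator {z. d < z \<bullet> e} z *\<^sub>R J z"
  proof (cases "d < z \<bullet> e")
    case True
    hence "z \<noteq> 0" using d by auto
    thus ?thesis using J_pos[of z] True by (auto simp: indicator_def)
  qed (use d in auto)
qed (use halfspace_integrable[OF e, of d] halfspace_integrable[OF e, of d'] d in \<open>auto simp: set_integrable_def\<close>)

lemma halfspace_translate:
  assumes e: "norm e = 1" and x: "l < x \<bullet> e"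
  shows "integrable lborel (\<lambda>y. indicator {y. y \<bullet> e < l} y * J (x - y))"
    and "(\<integral>y. indicator {y. y \<bullet> e < l} y * J (x - y) \<partial>lborel) = halfspace_mass e (x \<bullet> e - l)"
proof -
  let ?g = "\<lambda>z. indicator {z. x \<bullet> e - l < z \<bullet> e} z * J z"
  have eq: "(\<lambda>y. indicator {y. y \<bullet> e < l} y * J (x - y)) = (\<lambda>y. ?g (x - y))"
    by (auto simp: fun_eq_iff indicator_def inner_diff_left)
  show "integrable lborel (\<lambda>y. indicator {y. y \<bullet> e < l} y * J (x - y))"
    unfolding eq using halfspace_integrable[OF e, of "x \<bullet> e - l"] x
    by (subst measure_preserving_integrable[OF distr_lborel_point_reflection])
       (auto simp: set_integrable_def)
  show "(\<integral>y. indicator {y. y \<bullet> e < l} y * J (x - y) \<partial>lborel) = halfspace_mass e (x \<bullet> e - l)"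
    unfolding eq
    by (subst measure_preserving_integral[OF distr_lborel_point_reflection])
       (auto simp: halfspace_mass_def set_lebesgue_integral_def)
qed

lemma norm_less_reflect:
  assumes e: "norm e = 1" and "l < x \<bullet> e" "l < y \<bullet> e"
  shows "norm (x - y) < norm (x - reflect e l y)"
proof -
  have "0 < (l - y \<bullet> e) * (l - x \<bullet> e)" using assms by (intro mult_neg_neg) auto
  hence "(norm (x - y))\<^sup>2 < (norm (x - reflect e l y))\<^sup>2"
    using norm_diff_reflect_sq[OF e, of l y x]
    by (simp only: norm_minus_commute[of x] mult.assoc)
  thus ?thesis by (rule power2_less_imp_less) simp
qed

text \<open>The integral identity behind all maximum principles used here. Fold the half-space
\<open>{y. y \<bullet> e < l}\<close> onto the half-space \<open>\<Sigma> = {y. l < y \<bullet> e}\<close> of \<open>x0\<close>. With \<open>J\<close> evaluated at \<open>x0 - y\<close>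
and \<open>J'\<close> at \<open>x0 - reflect e l y\<close>, antisymmetry turns the folded integrand into
\<open>(w x0 - w y) J + (w x0 + w y) J' = 2 (w x0) J' - (w y - w x0) (J - J')\<close>.
The first term integrates to the half-space mass. The second has a sign, because
\<open>x0\<close> is a minimum point on \<open>\<Sigma>\<close> and \<open>J' \<le> J\<close> there, so its integral may be restricted to any
\<open>E \<subseteq> \<Sigma>\<close>. The excised ball around \<open>x0\<close> affects only the bounded kernel \<open>J'\<close>, and this error
vanishes with the radius.\<close>

lemma principal_value_le:
  fixes w :: "'a \<Rightarrow> real"
  assumes e: "norm e = 1"
    and [measurable]: "w \<in> borel_measurable borel"
    and bdd: "\<And>y. \<bar>w y\<bar> \<le> B"
    and anti: "\<And>y. w (reflect e l y) = - w y"
    and x0: "l < x0 \<bullet> e"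
    and min: "\<And>y. l < y \<bullet> e \<Longrightarrow> w x0 \<le> w y"
    and pv: "has_pv_integral (\<lambda>y. (w x0 - w y) * J (x0 - y)) I x0"
    and E: "E \<in> sets borel" "E \<subseteq> {y. l < y \<bullet> e}" "0 < r" "E \<inter> ball x0 r = {}"
  shows "set_integrable lborel E (\<lambda>y. (w y - w x0) * (J (x0 - y) - J (x0 - reflect e l y)))"
    and "I \<le> 2 * w x0 * halfspace_mass e (x0 \<bullet> e - l)
           - (LINT y:E|lborel. (w y - w x0) * (J (x0 - y) - J (x0 - reflect e l y)))"
proof -
  note [measurable] = E(1)
  define \<rho> where "\<rho> = x0 \<bullet> e - l"
  have \<rho>: "0 < \<rho>" using x0 by (simp add: \<rho>_def)
  define R where "R = reflect e l"
  have [measurable]: "R \<in> borel_measurable borel" by (simp add: R_def)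
  define \<Sigma> where "\<Sigma> = {y. l < y \<bullet> e}"
  define T where "T = {y. y \<bullet> e < l}"
  have [measurable]: "\<Sigma> \<in> sets borel" "T \<in> sets borel"
    by (auto simp: \<Sigma>_def T_def)
  define J' where "J' = (\<lambda>y. J (x0 - R y))"
  have [measurable]: "J' \<in> borel_measurable borel" by (simp add: J'_def)
  define h where "h = (\<lambda>y. (w x0 - w y) * J (x0 - y))"
  have [measurable]: "h \<in> borel_measurable borel" by (simp add: h_def)
  define D where "D = (\<lambda>y. (w y - w x0) * (J (x0 - y) - J' y))"
  have [measurable]: "D \<in> borel_measurable borel" by (simp add: D_def)
  define M where "M = J (\<rho> *\<^sub>R e)"
  have normR: "\<rho> < norm (x0 - R y)" if "y \<in> \<Sigma>" for y
  proof -
    have "\<rho> < (x0 - R y) \<bullet> e"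
      using that by (simp add: R_def inner_diff_left inner_reflect[OF e] \<Sigma>_def \<rho>_def)
    also have "\<dots> \<le> norm (x0 - R y)" by (rule inner_le_norm_unit[OF e])
    finally show ?thesis .
  qed
  have J'_pos: "0 < J' y" if "y \<in> \<Sigma>" for y
    using normR[OF that] \<rho> by (auto simp: J'_def intro!: J_pos)
  have J'_le: "J' y \<le> M" if "y \<in> \<Sigma>" for y
    unfolding J'_def M_def using normR[OF that] \<rho> e by (intro J_le) auto
  have J'_J: "J' y \<le> J (x0 - y)" if "y \<in> \<Sigma>" "y \<noteq> x0" for y
    unfolding J'_def R_def using norm_less_reflect[OF e x0, of y] that
    by (intro J_le) (auto simp: \<Sigma>_def)
  have M: "0 \<le> M" unfolding M_def using \<rho> e by (intro less_imp_le J_pos) auto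
  have B: "0 \<le> B" using bdd[of x0] by linarith
  have wB: "w y - w x0 \<le> 2 * B" for y using bdd[of y] bdd[of x0] by linarith
  have D_nonneg: "0 \<le> D y" if "y \<in> \<Sigma>" "y \<noteq> x0" for y
    unfolding D_def using min[of y] J'_J[OF that] that by (intro mult_nonneg_nonneg) (auto simp: \<Sigma>_def)
  have indR: "indicator T (R y) = (indicator \<Sigma> y :: real)" for y
    by (auto simp: indicator_def T_def \<Sigma>_def R_def inner_reflect[OF e])
  have RR: "R (R y) = y" for y by (simp add: R_def reflect_reflect[OF e])
  have pres: "distr lborel borel R = lborel" by (simp add: R_def distr_lborel_reflect[OF e])
  have intJ': "integrable lborel (\<lambda>y. indicator \<Sigma> y * J' y)"
    using measure_preserving_integrable[OF pres, of "\<lambda>y. indicator T y * J (x0 - y)"]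
      halfspace_translate(1)[OF e x0] by (simp add: indR J'_def T_def[symmetric])
  have eqJ': "(\<integral>y. indicator \<Sigma> y * J' y \<partial>lborel) = halfspace_mass e \<rho>"
    using measure_preserving_integral[OF pres, of "\<lambda>y. indicator T y * J (x0 - y)"]
      halfspace_translate(2)[OF e x0] by (simp add: indR J'_def T_def[symmetric] \<rho>_def)
  have E\<Sigma>: "E \<subseteq> \<Sigma>" using E(2) by (simp add: \<Sigma>_def)
  have intE: "integrable lborel (\<lambda>y. indicator E y * D y)"
  proof -
    have "set_integrable lborel (- ball x0 r) h"
      using pv \<open>0 < r\<close> by (auto simp: has_pv_integral_def h_def)
    hence "set_integrable lborel E h"
      by (rule set_integrable_subset) (use E in auto)
    hence 1: "integrable lborel (\<lambda>y. indicator E y * h y)" by (simp add: set_integrable_def)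
    have 2: "integrable lborel (\<lambda>y. indicator E y * ((w y - w x0) * J' y))"
    proof (rule Bochner_Integration.integrable_bound)
      show "integrable lborel (\<lambda>y. 2 * B * (indicator \<Sigma> y * J' y))"
        using intJ' by simp
      have "norm (indicator E y * ((w y - w x0) * J' y)) \<le> norm (2 * B * (indicator \<Sigma> y * J' y))" for y
      proof (cases "y \<in> E")
        case True
        hence y: "y \<in> \<Sigma>" using E\<Sigma> by auto
        have "\<bar>w y - w x0\<bar> * J' y \<le> 2 * B * J' y"
          using J'_pos[OF y] min[of y] wB[of y] y by (intro mult_right_mono) (auto simp: \<Sigma>_def)
        thus ?thesis using True y J'_pos[OF y] B by (simp add: abs_mult)
      qed auto
      thus "AE y in lborel. norm (indicator E y * ((w y - w x0) * J' y))
          \<le> norm (2 * B * (indicator \<Sigma> y * J' y))" by auto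
    qed measurable
    have "(\<lambda>y. indicator E y * D y)
        = (\<lambda>y. - (indicator E y * h y) - indicator E y * ((w y - w x0) * J' y))"
      by (auto simp: fun_eq_iff D_def h_def algebra_simps)
    thus ?thesis using 1 2 by simp
  qed
  let ?C = "2 * w x0 * halfspace_mass e \<rho> - (\<integral>y. indicator E y * D y \<partial>lborel)"
  have le: "(LINT y:- ball x0 \<epsilon>|lborel. h y) \<le> ?C + 2 * B * M * measure lborel (ball x0 \<epsilon>)"
    if \<epsilon>: "0 < \<epsilon>" "\<epsilon> < \<rho>" "\<epsilon> < r" for \<epsilon>
  proof -
    have T_off: "T \<subseteq> - ball x0 \<epsilon>"
    proof
      fix y assume "y \<in> T"
      hence "\<rho> < (x0 - y) \<bullet> e" by (simp add: T_def \<rho>_def inner_diff_left)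
      also have "\<dots> \<le> norm (x0 - y)" by (rule inner_le_norm_unit[OF e])
      finally show "y \<in> - ball x0 \<epsilon>" using \<epsilon> by (auto simp: dist_norm)
    qed
    have h: "set_integrable lborel (- ball x0 \<epsilon>) h"
      using pv \<epsilon> by (auto simp: has_pv_integral_def h_def)
    have hS: "integrable lborel (\<lambda>y. indicator (\<Sigma> - ball x0 \<epsilon>) y * h y)"
      using set_integrable_subset[OF h, of "\<Sigma> - ball x0 \<epsilon>"] by (auto simp: set_integrable_def)
    have hT: "integrable lborel (\<lambda>y. indicator T y * h y)"
      using set_integrable_subset[OF h, of T] T_off by (auto simp: set_integrable_def)
    \<comment> \<open>The contribution of the far half-space, carried to \<open>\<Sigma>\<close> by the reflection.\<close>
    have fold: "(\<lambda>y. indicator T (R y) * h (R y)) = (\<lambda>y. indicator \<Sigma> y * ((w x0 + w y) * J' y))"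
      by (rule ext) (simp add: indR h_def J'_def anti[folded R_def])
    have hT': "integrable lborel (\<lambda>y. indicator \<Sigma> y * ((w x0 + w y) * J' y))"
      unfolding fold[symmetric] using hT
      by (subst measure_preserving_integrable[OF pres, of "\<lambda>y. indicator T y * h y"]) auto
    have eqT: "(\<integral>y. indicator \<Sigma> y * ((w x0 + w y) * J' y) \<partial>lborel) = (\<integral>y. indicator T y * h y \<partial>lborel)"
      unfolding fold[symmetric]
      by (subst measure_preserving_integral[OF pres, of "\<lambda>y. indicator T y * h y"]) auto
    have "e \<noteq> 0" using e by auto
    have [measurable]: "ball x0 \<epsilon> \<in> sets borel" by simp
    have "(LINT y:- ball x0 \<epsilon>|lborel. h y)
        = (\<integral>y. indicator (\<Sigma> - ball x0 \<epsilon>) y * h y + indicator T y * h y \<partial>lborel)"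
      unfolding set_lebesgue_integral_def
    proof (rule integral_cong_AE)
      show "AE y in lborel. indicator (- ball x0 \<epsilon>) y *\<^sub>R h y
          = indicator (\<Sigma> - ball x0 \<epsilon>) y * h y + indicator T y * h y"
        using AE_inner_neq[OF \<open>e \<noteq> 0\<close>, of l]
      proof eventually_elim
        case (elim y)
        thus ?case using T_off by (auto simp: indicator_def \<Sigma>_def T_def subset_iff)
      qed
    qed measurable
    also have "\<dots> = (\<integral>y. indicator (\<Sigma> - ball x0 \<epsilon>) y * h y
        + indicator \<Sigma> y * ((w x0 + w y) * J' y) \<partial>lborel)"
      using hS hT hT' by (simp add: eqT)
    also have "\<dots> \<le> (\<integral>y. 2 * w x0 * (indicator \<Sigma> y * J' y) - indicator E y * D y
        + 2 * B * M * indicator (ball x0 \<epsilon>) y \<partial>lborel)"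
    proof (rule integral_mono)
      show "integrable lborel (\<lambda>y. 2 * w x0 * (indicator \<Sigma> y * J' y) - indicator E y * D y
        + 2 * B * M * indicator (ball x0 \<epsilon>) y)"
        using intJ' intE emeasure_lborel_ball_finite[of x0 \<epsilon>]
        by (intro Bochner_Integration.integrable_add Bochner_Integration.integrable_diff
             integrable_mult_right integrable_real_indicator) auto
      fix y
      consider "y \<notin> \<Sigma>" | "y \<in> \<Sigma>" "y \<in> ball x0 \<epsilon>" | "y \<in> \<Sigma>" "y \<notin> ball x0 \<epsilon>" by blast
      thus "indicator (\<Sigma> - ball x0 \<epsilon>) y * h y + indicator \<Sigma> y * ((w x0 + w y) * J' y)
        \<le> 2 * w x0 * (indicator \<Sigma> y * J' y) - indicator E y * D y
          + 2 * B * M * indicator (ball x0 \<epsilon>) y"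
      \<comment> \<open>In the second case the ball contributes only the folded part, which \<open>2 * B * M\<close> absorbs.\<close>
      proof cases
        case 1
        thus ?thesis using E\<Sigma> B M by (auto simp: indicator_def)
      next
        case 2
        have "y \<notin> E" using 2 E(4) \<epsilon> by auto
        have "(w y - w x0) * J' y \<le> (2 * B) * M"
          using J'_pos[OF 2(1)] J'_le[OF 2(1)] wB[of y] B min[of y] 2
          by (intro mult_mono) (auto simp: \<Sigma>_def)
        thus ?thesis using 2 \<open>y \<notin> E\<close> by (simp add: algebra_simps)
      next
        case 3
        hence "y \<noteq> x0" using \<epsilon> by auto
        hence "indicator E y * D y \<le> D y" using D_nonneg[of y] 3 by (auto simp: indicator_def)
        moreover have "h y + (w x0 + w y) * J' y = 2 * w x0 * J' y - D y"
          by (simp add: h_def D_def algebra_simps)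
        ultimately show ?thesis using 3 by simp
      qed
    qed (use hS hT' in auto)
    also have "\<dots> = ?C + 2 * B * M * measure lborel (ball x0 \<epsilon>)"
      using intJ' intE emeasure_lborel_ball_finite[of x0 \<epsilon>] by (simp add: eqJ')
    finally show ?thesis .
  qed
  have "I \<le> ?C"
  proof (rule tendsto_le)
    show "((\<lambda>\<epsilon>. LINT y:- ball x0 \<epsilon>|lborel. h y) \<longlongrightarrow> I) (at_right 0)"
      using pv by (simp add: has_pv_integral_def h_def)
    have "((\<lambda>\<epsilon>. ?C + 2 * B * M * (unit_ball_vol (DIM('a)) * \<epsilon> ^ DIM('a))) \<longlongrightarrow> ?C) (at_right 0)"
      by (auto intro!: tendsto_eq_intros)
    thus "((\<lambda>\<epsilon>. ?C + 2 * B * M * measure lborel (ball x0 \<epsilon>)) \<longlongrightarrow> ?C) (at_right 0)"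
    proof (rule Lim_transform_eventually)
      show "\<forall>\<^sub>F \<epsilon> in at_right 0. ?C + 2 * B * M * (unit_ball_vol (DIM('a)) * \<epsilon> ^ DIM('a))
          = ?C + 2 * B * M * measure lborel (ball x0 \<epsilon>)"
        using eventually_at_right_less[of 0] by eventually_elim (simp add: content_ball)
    qed
    show "\<forall>\<^sub>F \<epsilon> in at_right 0. (LINT y:- ball x0 \<epsilon>|lborel. h y)
        \<le> ?C + 2 * B * M * measure lborel (ball x0 \<epsilon>)"
      using eventually_at_right_real[of 0 "min \<rho> r"] \<rho> \<open>0 < r\<close>
      by (auto elim!: eventually_mono intro!: le)
  qed simp
  thus "I \<le> 2 * w x0 * halfspace_mass e (x0 \<bullet> e - l)
           - (LINT y:E|lborel. (w y - w x0) * (J (x0 - y) - J (x0 - reflect e l y)))"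
    by (simp add: \<rho>_def D_def J'_def R_def set_lebesgue_integral_def)
  show "set_integrable lborel E (\<lambda>y. (w y - w x0) * (J (x0 - y) - J (x0 - reflect e l y)))"
    using intE by (simp add: D_def J'_def R_def set_integrable_def)
qed

end

text \<open>The power \<open>DIM('a)\<close> is the borderline of integrability at the origin: any kernel bounded below in
this way has infinite mass on every half-space bounded by a hyperplane through the origin.\<close>

locale singular_kernel = radial_decreasing_kernel +
  fixes c \<rho> :: real
  assumes c_pos: "0 < c" and \<rho>_pos: "0 < \<rho>"
    and J_lower: "x \<noteq> 0 \<Longrightarrow> norm x \<le> \<rho> \<Longrightarrow> c / norm x ^ DIM('a) \<le> J x"
begin

text \<open>By scaling, the bound on \<open>J\<close> gives each of the dyadic balls of radius \<open>a k = \<rho> / 5 / 2 ^ k\<close> around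
\<open>4 (a k) e\<close> at least the same mass \<open>q\<close>. These balls are disjoint, because along \<open>e\<close> they
occupy the intervals from \<open>3 (a k)\<close> to \<open>5 (a k)\<close>, so \<open>n\<close> of them have mass at least \<open>n q\<close>. The
count does not depend on \<open>e\<close>.\<close>

lemma halfspace_mass_unbounded:
  obtains d where "0 < d" "\<And>e. norm e = 1 \<Longrightarrow> M \<le> halfspace_mass e d"
proof -
  define N where "N = DIM('a)"
  define q where "q = c * unit_ball_vol N / 5 ^ N"
  have q: "0 < q" using c_pos by (simp add: q_def)
  obtain n where n: "M \<le> real n * q"
    using reals_Archimedean3[OF q] by (metis less_imp_le)
  define a where "a k = \<rho> / 5 / 2 ^ k" for k :: nat
  have a_pos: "0 < a k" for k using \<rho>_pos by (simp add: a_def)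
  have a_mono: "a k \<le> a j" if "j \<le> k" for j k
    unfolding a_def using that \<rho>_pos by (intro divide_left_mono) auto
  have a_gap: "2 * a k \<le> a j" if "j < k" for j k
    using a_mono[of "Suc j" k] that by (simp add: a_def field_simps)
  have "M \<le> halfspace_mass e (a n)" if e: "norm e = 1" for e
  proof -
    define U where "U k = ball ((4 * a k) *\<^sub>R e) (a k)" for k
    have U: "3 * a k < z \<bullet> e" "z \<bullet> e < 5 * a k" "norm z \<le> 5 * a k" if "z \<in> U k" for z k
    proof -
      have ee: "e \<bullet> e = 1" using e by (simp flip: power2_norm_eq_inner)
      have d: "norm (z - (4 * a k) *\<^sub>R e) < a k"
        using that by (simp add: U_def dist_norm norm_minus_commute)
      have "\<bar>(z - (4 * a k) *\<^sub>R e) \<bullet> e\<bar> < a k"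
        using Cauchy_Schwarz_ineq2[of "z - (4 * a k) *\<^sub>R e" e] d e by simp
      thus "3 * a k < z \<bullet> e" "z \<bullet> e < 5 * a k"
        by (simp_all add: inner_diff_left ee abs_less_iff)
      have "norm z \<le> norm (z - (4 * a k) *\<^sub>R e) + norm ((4 * a k) *\<^sub>R e)"
        using norm_triangle_ineq[of "z - (4 * a k) *\<^sub>R e" "(4 * a k) *\<^sub>R e"] by simp
      thus "norm z \<le> 5 * a k" using d e a_pos[of k] by simp
    qed
    \<comment> \<open>\<open>5 * a k \<le> 5 / 2 * a j < 3 * a j\<close> for \<open>j < k\<close>.\<close>
    have disj: "j = k" if "z \<in> U j" "z \<in> U k" for z j k
    proof (rule ccontr)
      assume "j \<noteq> k"
      have False if "j < k" "z \<in> U j" "z \<in> U k" for j k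
        using U(1)[OF that(2)] U(2)[OF that(3)] a_gap[OF that(1)] a_pos[of k] a_pos[of j] by linarith
      thus False using that \<open>j \<noteq> k\<close> by (metis linorder_neqE_nat)
    qed
    let ?F = "\<lambda>z. \<Sum>k<n. c / (5 * a k) ^ N * indicator (U k) z"
    have fin: "emeasure lborel (U k) < \<infinity>" for k
      unfolding U_def by (rule emeasure_lborel_ball_finite)
    have [measurable]: "U k \<in> sets borel" for k by (simp add: U_def)
    have "real n * q = (\<Sum>k<n. c / (5 * a k) ^ N * measure lborel (U k))"
    proof -
      have "c / (5 * a k) ^ N * measure lborel (U k) = q" for k
        using a_pos[of k] by (simp add: U_def content_ball q_def N_def power_mult_distrib)
      thus ?thesis by simp
    qed
    also have "\<dots> = (\<integral>z. ?F z \<partial>lborel)"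
      using fin by (subst Bochner_Integration.integral_sum) (auto intro!: integrable_mult_right integrable_real_indicator)
    also have "\<dots> \<le> (\<integral>z. indicator {z. a n < z \<bullet> e} z *\<^sub>R J z \<partial>lborel)"
    proof (rule integral_mono)
      show "integrable lborel ?F"
        using fin by (intro Bochner_Integration.integrable_sum integrable_mult_right integrable_real_indicator) auto
      show "integrable lborel (\<lambda>z. indicator {z. a n < z \<bullet> e} z *\<^sub>R J z)"
        using halfspace_integrable[OF e a_pos] by (simp add: set_integrable_def)
      fix z
      show "?F z \<le> indicator {z. a n < z \<bullet> e} z *\<^sub>R J z"
      proof (cases "\<exists>k<n. z \<in> U k")
        case True
        then obtain k where k: "k < n" "z \<in> U k" by blast
        have "z \<in> U j \<longleftrightarrow> j = k" for j
          using disj[of z j k] k(2) by blast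
        hence "?F z = (\<Sum>j<n. if j = k then c / (5 * a k) ^ N else 0)"
          by (intro sum.cong) (auto simp: indicator_def)
        hence Fz: "?F z = c / (5 * a k) ^ N" using k by simp
        have ze: "a n < z \<bullet> e" using U(1)[OF k(2)] a_mono[of k n] a_pos[of k] k(1) by linarith
        hence z0: "z \<noteq> 0" using a_pos[of n] by auto
        have "5 * a k \<le> \<rho>" using a_mono[of 0 k] by (simp add: a_def)
        have "c / (5 * a k) ^ N \<le> c / norm z ^ N"
          using c_pos z0 U(3)[OF k(2)] by (intro divide_left_mono power_mono mult_pos_pos) (auto simp: a_pos)
        also have "\<dots> \<le> J z"
          unfolding N_def using z0 U(3)[OF k(2)] \<open>5 * a k \<le> \<rho>\<close> by (intro J_lower) auto
        finally show ?thesis using ze unfolding Fz by simp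
      next
        case False
        hence "?F z = 0" by (intro sum.neutral) auto
        moreover have "0 \<le> indicator {z. a n < z \<bullet> e} z *\<^sub>R J z"
          using J_pos[of z] a_pos[of n] by (cases "z = 0") (auto simp: indicator_def)
        ultimately show ?thesis by simp
      qed
    qed
    finally show ?thesis using n by (simp add: halfspace_mass_def set_lebesgue_integral_def)
  qed
  thus thesis using that[of "a n"] a_pos by blast
qed

end

section \<open>The Bessel kernel\<close>

lemma set_integrable_exp_minus: "set_integrable lborel {0..} (\<lambda>t::real. exp (- t))"
proof -
  have "set_integrable lebesgue {0..} (\<lambda>t::real. exp (- t))"
    using integrable_on_exp_minus_to_infinity[of 1 0]
    by (intro nonnegative_absolutely_integrable_1) auto
  thus ?thesis
    unfolding set_integrable_def by (subst (asm) integrable_completion) auto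
qed

lemma cosh_ge_half_exp: "exp t / 2 \<le> cosh (t::real)"
  by (simp add: cosh_field_def)

lemma cosh_le_exp: "0 \<le> t \<Longrightarrow> cosh (t::real) \<le> exp t"
  by (simp add: cosh_field_def)

lemma borel_measurable_cosh [measurable]: "(cosh :: real \<Rightarrow> real) \<in> borel_measurable borel"
  by (intro borel_measurable_continuous_onI continuous_intros)

text \<open>From \<open>cosh t \<ge> exp t / 2 \<ge> t\<^sup>2 / 4\<close> the integrand is dominated by a Gaussian times
\<open>exp (\<nu> t)\<close>; completing the square bounds that by a multiple of \<open>exp (- t)\<close>.\<close>

lemma bessel_K_integrable:
  fixes \<nu> r :: real
  assumes \<nu>: "0 \<le> \<nu>" and r: "0 < r"
  shows "set_integrable lborel {0..} (\<lambda>t. exp (- r * cosh t) * cosh (\<nu> * t))"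
proof -
  define C where "C = (\<nu> + 1)\<^sup>2 / r"
  have bound: "exp (- r * cosh t) * cosh (\<nu> * t) \<le> exp C * exp (- t)" if t: "0 \<le> t" for t
  proof -
    have "t\<^sup>2 / 4 \<le> cosh t"
      using exp_lower_Taylor_quadratic[OF t] cosh_ge_half_exp[of t] t by linarith
    hence "exp (- r * cosh t) \<le> exp (- r * (t\<^sup>2 / 4))" using r by simp
    moreover have "cosh (\<nu> * t) \<le> exp (\<nu> * t)" using \<nu> t by (intro cosh_le_exp) simp
    ultimately have "exp (- r * cosh t) * cosh (\<nu> * t) \<le> exp (- r * (t\<^sup>2 / 4)) * exp (\<nu> * t)"
      by (intro mult_mono) auto
    also have "\<dots> = exp (\<nu> * t - r * t\<^sup>2 / 4)" by (simp flip: exp_add)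
    also have "\<dots> \<le> exp (C - t)"
    proof -
      have "0 \<le> (r * t / 2 - (\<nu> + 1))\<^sup>2 / r" using r by simp
      also have "\<dots> = r * t\<^sup>2 / 4 - (\<nu> + 1) * t + C"
        using r by (simp add: C_def power2_eq_square field_simps)
      finally show ?thesis by (simp add: algebra_simps)
    qed
    finally show ?thesis by (simp flip: exp_add)
  qed
  have "set_integrable lborel {0..} (\<lambda>t. exp C * exp (- t))"
    using set_integrable_exp_minus by simp
  thus ?thesis
    unfolding set_integrable_def
    by (rule Bochner_Integration.integrable_bound)
       (use bound in \<open>auto simp: indicator_def abs_mult intro!: AE_I2\<close>)
qed

lemma bessel_K_antimono:
  assumes "0 \<le> \<nu>" "0 < r" "r \<le> r'"
  shows "bessel_K \<nu> r' \<le> bessel_K \<nu> r"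
  unfolding bessel_K_def
proof (rule set_integral_mono)
  show "exp (- r' * cosh t) * cosh (\<nu> * t) \<le> exp (- r * cosh t) * cosh (\<nu> * t)" for t
    using assms by (intro mult_right_mono) auto
qed (use assms bessel_K_integrable[of \<nu>] in auto)

text \<open>Keep only the part of the integral over the unit interval from \<open>T - 1\<close> to \<open>T\<close>.\<close>

lemma bessel_K_ge:
  assumes \<nu>: "0 \<le> \<nu>" and r: "0 < r" and T: "1 \<le> T"
  shows "exp (- r * exp T) * (exp (\<nu> * (T - 1)) / 2) \<le> bessel_K \<nu> r"
proof -
  let ?C = "exp (- r * exp T) * (exp (\<nu> * (T - 1)) / 2)"
  have "?C = (\<integral>t. indicator {T - 1..T} t *\<^sub>R ?C \<partial>lborel)"
    by simp
  also have "\<dots> \<le> (\<integral>t. indicator {0..} t *\<^sub>R (exp (- r * cosh t) * cosh (\<nu> * t)) \<partial>lborel)"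
  proof (rule integral_mono)
    show "integrable lborel (\<lambda>t. indicator {T - 1..T} t *\<^sub>R ?C)" by simp
    show "integrable lborel (\<lambda>t. indicator {0..} t *\<^sub>R (exp (- r * cosh t) * cosh (\<nu> * t)))"
      using bessel_K_integrable[OF \<nu> r] by (simp add: set_integrable_def)
    fix t
    show "indicator {T - 1..T} t *\<^sub>R ?C \<le> indicator {0..} t *\<^sub>R (exp (- r * cosh t) * cosh (\<nu> * t))"
    proof (cases "t \<in> {T - 1..T}")
      case True
      hence t: "0 \<le> t" "t \<le> T" "T - 1 \<le> t" using T by auto
      have "cosh t \<le> exp T" using cosh_le_exp[OF t(1)] t(2) by (meson exp_le_cancel_iff order_trans)
      hence "exp (- r * exp T) \<le> exp (- r * cosh t)" using r by simp
      moreover have "exp (\<nu> * (T - 1)) / 2 \<le> cosh (\<nu> * t)"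
      proof -
        have "exp (\<nu> * (T - 1)) \<le> exp (\<nu> * t)" using \<nu> t by (simp add: mult_left_mono)
        thus ?thesis using cosh_ge_half_exp[of "\<nu> * t"] by linarith
      qed
      ultimately have "?C \<le> exp (- r * cosh t) * cosh (\<nu> * t)" by (intro mult_mono) auto
      thus ?thesis using True t by simp
    next
      case False
      thus ?thesis by (auto simp: indicator_def)
    qed
  qed
  finally show ?thesis by (simp add: bessel_K_def set_lebesgue_integral_def)
qed

lemma bessel_K_pos:
  assumes "0 \<le> \<nu>" "0 < r"
  shows "0 < bessel_K \<nu> r"
proof -
  have "0 < exp (- r * exp 1) * (exp (\<nu> * (1 - 1)) / 2)" by simp
  also have "\<dots> \<le> bessel_K \<nu> r" by (rule bessel_K_ge) (use assms in auto)
  finally show ?thesis .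
qed

text \<open>Take \<open>T = - ln r\<close> above: the interval where \<open>r cosh t\<close> is still of order one, while
\<open>cosh (\<nu> t)\<close> has already grown to the order of \<open>r powr (- \<nu>)\<close>.\<close>

lemma bessel_K_lower:
  assumes \<nu>: "0 \<le> \<nu>" and r: "0 < r" "r \<le> exp (- 1)"
  shows "exp (- 1 - \<nu>) / 2 * r powr (- \<nu>) \<le> bessel_K \<nu> r"
proof -
  have "ln r \<le> ln (exp (- 1))" using r by (subst ln_le_cancel_iff) auto
  hence "ln r \<le> - 1" by simp
  hence "exp (- r * exp (- ln r)) * (exp (\<nu> * (- ln r - 1)) / 2) \<le> bessel_K \<nu> r"
    using \<nu> r by (intro bessel_K_ge) auto
  also have "- r * exp (- ln r) = - 1" using r by (simp add: exp_minus)
  also have "exp (- 1) * (exp (\<nu> * (- ln r - 1)) / 2) = exp (- 1 - \<nu>) / 2 * r powr (- \<nu>)"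
    using r by (simp add: powr_def algebra_simps flip: exp_add)
  finally show ?thesis .
qed

lemma bessel_K_borel [measurable]: "bessel_K \<nu> \<in> borel_measurable borel"
  unfolding bessel_K_def[abs_def] set_lebesgue_integral_def by measurable

definition bessel_kernel :: "real \<Rightarrow> real \<Rightarrow> 'a::euclidean_space \<Rightarrow> real" where
  "bessel_kernel m \<alpha> z = bessel_K \<alpha> (m * norm z) / norm z powr \<alpha>"

lemma bessel_kernel_borel [measurable]: "bessel_kernel m \<alpha> \<in> borel_measurable borel"
  unfolding bessel_kernel_def[abs_def] by measurable

lemma bessel_kernel_pos:
  assumes "0 < m" "0 \<le> \<alpha>" "z \<noteq> 0"
  shows "0 < bessel_kernel m \<alpha> z"
  using assms by (auto simp: bessel_kernel_def intro!: divide_pos_pos bessel_K_pos)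

lemma bessel_kernel_less:
  assumes "0 < m" "0 < \<alpha>" "z \<noteq> 0" "norm z < norm z'"
  shows "bessel_kernel m \<alpha> z' < bessel_kernel m \<alpha> z"
proof -
  have z: "0 < norm z" using assms by simp
  have "bessel_K \<alpha> (m * norm z') / norm z' powr \<alpha> \<le> bessel_K \<alpha> (m * norm z) / norm z' powr \<alpha>"
    using assms by (intro divide_right_mono bessel_K_antimono) auto
  also have "\<dots> < bessel_K \<alpha> (m * norm z) / norm z powr \<alpha>"
  proof (rule divide_strict_left_mono)
    show "norm z powr \<alpha> < norm z' powr \<alpha>"
      using assms by (intro powr_less_mono2) auto
    have "0 < norm z'" using z assms(4) by linarith
    thus "0 < norm z' powr \<alpha> * norm z powr \<alpha>" using z by simp
  qed (use assms in \<open>auto intro!: bessel_K_pos\<close>)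
  finally show ?thesis by (simp add: bessel_kernel_def)
qed

text \<open>Near the origin the kernel grows like \<open>norm z powr (- 2 * \<alpha>)\<close>, where \<open>2 * \<alpha> = DIM('a) + 2 * s\<close>,
which beats the borderline power.\<close>

lemma bessel_kernel_lower:
  assumes m: "0 < m" and s: "0 \<le> s"
    and z: "z \<noteq> 0" "norm z \<le> min 1 (exp (- 1) / m)"
  defines "\<alpha> \<equiv> real DIM('a) / 2 + s"
  shows "exp (- 1 - \<alpha>) / 2 * m powr (- \<alpha>) / norm (z::'a::euclidean_space) ^ DIM('a) \<le> bessel_kernel m \<alpha> z"
proof -
  let ?c = "exp (- 1 - \<alpha>) / 2 * m powr (- \<alpha>)"
  have n: "0 < norm z" "norm z \<le> 1" using z by auto
  have \<alpha>: "0 \<le> \<alpha>" using s by (simp add: \<alpha>_def)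
  have "m * norm z \<le> exp (- 1)" using z m by (simp add: field_simps)
  hence K: "exp (- 1 - \<alpha>) / 2 * (m * norm z) powr (- \<alpha>) \<le> bessel_K \<alpha> (m * norm z)"
    using m n \<alpha> by (intro bessel_K_lower) auto
  have "?c / norm z ^ DIM('a) = ?c * norm z powr (- real DIM('a))"
    using n by (simp add: powr_minus_divide powr_realpow)
  also have "\<dots> \<le> ?c * norm z powr (- \<alpha> - \<alpha>)"
    using n s by (intro mult_left_mono powr_mono') (auto simp: \<alpha>_def)
  also have "\<dots> = exp (- 1 - \<alpha>) / 2 * (m * norm z) powr (- \<alpha>) / norm z powr \<alpha>"
    using m n unfolding powr_diff by (simp add: powr_mult)
  also have "\<dots> \<le> bessel_kernel m \<alpha> z"
    unfolding bessel_kernel_def using K by (intro divide_right_mono) auto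
  finally show ?thesis .
qed

section \<open>Principal values under differences and reflections\<close>

lemma has_pv_integral_diff:
  assumes "has_pv_integral g I x" "has_pv_integral h I' x"
  shows "has_pv_integral (\<lambda>y. g y - h y) (I - I') x"
  unfolding has_pv_integral_def
proof (intro conjI allI impI)
  have int: "set_integrable lborel (- ball x \<epsilon>) g" "set_integrable lborel (- ball x \<epsilon>) h"
    if "0 < \<epsilon>" for \<epsilon>
    using assms that by (auto simp: has_pv_integral_def)
  show "set_integrable lborel (- ball x \<epsilon>) (\<lambda>y. g y - h y)" if "0 < \<epsilon>" for \<epsilon>
    using int[OF that] by (rule set_integral_diff)
  have "((\<lambda>\<epsilon>. (LINT y:- ball x \<epsilon>|lborel. g y) - (LINT y:- ball x \<epsilon>|lborel. h y)) \<longlongrightarrow> I - I') (at_right 0)"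
    using assms by (intro tendsto_diff) (auto simp: has_pv_integral_def)
  thus "((\<lambda>\<epsilon>. LINT y:- ball x \<epsilon>|lborel. g y - h y) \<longlongrightarrow> I - I') (at_right 0)"
  proof (rule Lim_transform_eventually)
    show "\<forall>\<^sub>F \<epsilon> in at_right 0. (LINT y:- ball x \<epsilon>|lborel. g y) - (LINT y:- ball x \<epsilon>|lborel. h y)
        = (LINT y:- ball x \<epsilon>|lborel. g y - h y)"
      using eventually_at_right_less[of 0]
      by eventually_elim (simp add: set_integral_diff(2)[OF int])
  qed
qed

lemma has_pv_integral_reflect:
  assumes e: "norm e = 1" and [measurable]: "g \<in> borel_measurable borel"
    and pv: "has_pv_integral g I (reflect e l x)"
  shows "has_pv_integral (\<lambda>y. g (reflect e l y)) I x"
proof -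
  have eq: "indicator (- ball x \<epsilon>) y *\<^sub>R g (reflect e l y)
      = (\<lambda>z. indicator (- ball (reflect e l x) \<epsilon>) z *\<^sub>R g z) (reflect e l y)" for y \<epsilon>
    by (auto simp: indicator_def dist_norm norm_reflect_diff_reflect[OF e])
  have [measurable]: "ball (reflect e l x) \<epsilon> \<in> sets borel" for \<epsilon> by simp
  show ?thesis
    using pv unfolding has_pv_integral_def set_integrable_def set_lebesgue_integral_def eq
    by (subst measure_preserving_integrable[OF distr_lborel_reflect[OF e]],
        measurable,
        subst measure_preserving_integral[OF distr_lborel_reflect[OF e]],
        measurable)
qed

section \<open>Moving planes\<close>

text \<open>
The Dirichlet problem \<open>A * PV + b * u = f u\<close> on the unit ball for an arbitrary singular kernel; the
argument is insensitive to the particular form of the Bessel kernel.\<close>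

locale radial_dirichlet_problem = singular_kernel J c \<rho>
  for J :: "'a::euclidean_space \<Rightarrow> real" and c \<rho> +
  fixes u :: "'a \<Rightarrow> real" and f :: "real \<Rightarrow> real" and A b L :: real
  assumes A_pos: "0 < A" and b_nonneg: "0 \<le> b"
    and f_lipschitz: "L-lipschitz_on UNIV f"
    and u_continuous: "continuous_on UNIV u"
    and equation: "x \<in> ball 0 1 \<Longrightarrow>
      \<exists>I. has_pv_integral (\<lambda>y. (u x - u y) * J (x - y)) I x \<and> A * I + b * u x = f (u x)"
    and u_pos: "x \<in> ball 0 1 \<Longrightarrow> 0 < u x"
    and u_zero: "x \<notin> ball 0 1 \<Longrightarrow> u x = 0"
begin

definition gap :: "'a \<Rightarrow> real \<Rightarrow> 'a \<Rightarrow> real" where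
  "gap e l x = u (reflect e l x) - u x"

lemma u_nonneg: "0 \<le> u x"
  using u_pos[of x] u_zero[of x] by (cases "x \<in> ball 0 1") auto

lemma u_borel [measurable]: "u \<in> borel_measurable borel"
  using u_continuous by (rule borel_measurable_continuous_onI)

lemma gap_borel [measurable]: "gap e l \<in> borel_measurable borel"
  unfolding gap_def[abs_def] by measurable

lemma continuous_on_gap [continuous_intros]:
  assumes "continuous_on S g" "continuous_on S h"
  shows "continuous_on S (\<lambda>x. gap e (g x) (h x))"
  unfolding gap_def using assms
  by (intro continuous_intros continuous_on_compose2[OF u_continuous]) auto

lemma gap_reflect: "norm e = 1 \<Longrightarrow> gap e l (reflect e l x) = - gap e l x"
  by (simp add: gap_def reflect_reflect)

lemma gap_bounded: obtains B where "\<And>e l x. \<bar>gap e l x\<bar> \<le> B"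
proof -
  have "bounded (u ` cball 0 1)"
    using u_continuous by (intro compact_imp_bounded compact_continuous_image)
      (auto intro: continuous_on_subset)
  then obtain B where B: "\<And>x. x \<in> cball 0 1 \<Longrightarrow> \<bar>u x\<bar> \<le> B"
    unfolding bounded_iff by (metis imageI real_norm_def)
  have uB: "u x \<le> B" for x
  proof (cases "x \<in> ball 0 1")
    case True
    thus ?thesis using B[of x] by simp
  next
    case False
    thus ?thesis using B[of 0] u_zero[of x] by simp
  qed
  have "\<bar>gap e l x\<bar> \<le> B" for e l x
    using uB[of x] uB[of "reflect e l x"] u_nonneg[of x] u_nonneg[of "reflect e l x"]
    unfolding gap_def by linarith
  thus thesis by (rule that)
qed

lemma reflect_in_ball:
  assumes e: "norm e = 1" and l: "0 < l" "l < x \<bullet> e" and x: "x \<in> cball 0 1"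
  shows "reflect e l x \<in> ball 0 1"
proof -
  have "4 * l * (l - x \<bullet> e) < 0" using l by (intro mult_pos_neg) auto
  hence "(norm (reflect e l x))\<^sup>2 < (norm x)\<^sup>2" using norm_reflect_sq[OF e, of l x] by simp
  hence "norm (reflect e l x) < norm x" by (rule power2_less_imp_less) simp
  thus ?thesis using x by simp
qed

lemma gap_nonneg_outside: "x \<notin> ball 0 1 \<Longrightarrow> 0 \<le> gap e l x"
  using u_nonneg[of "reflect e l x"] u_zero[of x] by (simp add: gap_def)

text \<open>Subtract the equation at \<open>x\<close> from the equation at the mirror image of \<open>x\<close>, pulled back by the
reflection.\<close>

lemma gap_equation:
  assumes e: "norm e = 1" and x: "x \<in> ball 0 1" "reflect e l x \<in> ball 0 1"
  obtains I where "has_pv_integral (\<lambda>y. (gap e l x - gap e l y) * J (x - y)) I x"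
    and "A * I + b * gap e l x = f (u (reflect e l x)) - f (u x)"
proof -
  let ?R = "reflect e l"
  obtain I where I: "has_pv_integral (\<lambda>y. (u x - u y) * J (x - y)) I x" "A * I + b * u x = f (u x)"
    using equation[OF x(1)] by blast
  obtain I' where I': "has_pv_integral (\<lambda>y. (u (?R x) - u y) * J (?R x - y)) I' (?R x)"
    "A * I' + b * u (?R x) = f (u (?R x))"
    using equation[OF x(2)] by blast
  have JR: "J (?R x - ?R y) = J (x - y)" for y
    by (rule J_radial) (rule norm_reflect_diff_reflect[OF e])
  have "has_pv_integral (\<lambda>y. (u (?R x) - u (?R y)) * J (x - y)) I' x"
    using has_pv_integral_reflect[OF e _ I'(1)] by (simp add: JR)
  from has_pv_integral_diff[OF this I(1)]
  have "has_pv_integral (\<lambda>y. (gap e l x - gap e l y) * J (x - y)) (I' - I) x"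
    by (simp add: gap_def algebra_simps)
  moreover have "A * (I' - I) + b * gap e l x = f (u (?R x)) - f (u x)"
    using I(2) I'(2) by (simp add: gap_def algebra_simps)
  ultimately show thesis by (rule that)
qed

text \<open>At a negative minimum point of the gap the principal value is at most
\<open>2 * gap * halfspace_mass\<close>, whereas the equation and the Lipschitz bound make it at least
\<open>(L / A) * gap\<close>. Hence the half-space mass seen by the minimum point is at most \<open>L / (2 * A)\<close>. As this
mass is unbounded near the hyperplane, minimum points keep a distance \<open>\<delta>\<close> that is uniform in
\<open>e\<close> and \<open>l\<close>.\<close>

lemma narrow_region:
  obtains \<delta> where "0 < \<delta>"
    "\<And>e l x. norm e = 1 \<Longrightarrow> 0 < l \<Longrightarrow> l < x \<bullet> e \<Longrightarrow> x \<in> ball 0 1 \<Longrightarrow> gap e l x < 0 \<Longrightarrow>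
       (\<And>y. l < y \<bullet> e \<Longrightarrow> gap e l x \<le> gap e l y) \<Longrightarrow> \<delta> \<le> x \<bullet> e - l"
proof -
  obtain \<delta> where \<delta>: "0 < \<delta>" "\<And>e. norm e = 1 \<Longrightarrow> (L + 1) / (2 * A) \<le> halfspace_mass e \<delta>"
    using halfspace_mass_unbounded by blast
  obtain B where B: "\<And>e l x. \<bar>gap e l x\<bar> \<le> B" using gap_bounded by blast
  show thesis
  proof (rule that[OF \<delta>(1)], rule ccontr)
    fix e :: 'a and l x
    assume e: "norm e = 1" and l: "0 < l" "l < x \<bullet> e" and x: "x \<in> ball 0 1"
      and neg: "gap e l x < 0" and min: "\<And>y. l < y \<bullet> e \<Longrightarrow> gap e l x \<le> gap e l y"
      and near: "\<not> \<delta> \<le> x \<bullet> e - l"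
    let ?m = "halfspace_mass e (x \<bullet> e - l)"
    have "reflect e l x \<in> ball 0 1" using reflect_in_ball[OF e l] x by simp
    then obtain I where pv: "has_pv_integral (\<lambda>y. (gap e l x - gap e l y) * J (x - y)) I x"
      and I: "A * I + b * gap e l x = f (u (reflect e l x)) - f (u x)"
      using gap_equation[OF e x] by blast
    have "I \<le> 2 * gap e l x * ?m"
      using principal_value_le(2)[OF e gap_borel B gap_reflect[OF e] l(2) min pv, of "{}" 1]
      by (simp add: set_lebesgue_integral_def)
    hence "A * I \<le> (2 * A * ?m) * gap e l x" using A_pos by (simp add: mult_ac)
    moreover have "L * gap e l x \<le> f (u (reflect e l x)) - f (u x)"
    proof -
      have "\<bar>f (u (reflect e l x)) - f (u x)\<bar> \<le> L * \<bar>gap e l x\<bar>"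
        using lipschitz_onD[OF f_lipschitz, of "u (reflect e l x)" "u x"]
        by (simp add: dist_real_def gap_def)
      moreover have "L * \<bar>gap e l x\<bar> = - (L * gap e l x)" using neg by simp
      ultimately show ?thesis by linarith
    qed
    moreover have "b * gap e l x \<le> 0" using b_nonneg neg by (simp add: mult_nonneg_nonpos)
    ultimately have "L * gap e l x \<le> (2 * A * ?m) * gap e l x" using I by linarith
    hence "2 * A * ?m \<le> L" using neg by (simp add: mult_le_cancel_right)
    moreover have "(L + 1) / (2 * A) \<le> ?m"
      using \<delta>(2)[OF e] halfspace_mass_antimono[OF e, of "x \<bullet> e - l" \<delta>] l near by simp
    hence "L + 1 \<le> 2 * A * ?m" using A_pos by (simp add: field_simps)
    ultimately show False by linarith
  qed
qed

text \<open>If the gap vanished at an interior point, the principal value there would be zero, and the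
maximum principle would force the gap to vanish almost everywhere on the half-space. But the gap is
positive at points outside the ball that are reflected into it, and for \<open>l > 0\<close> these form a
nonempty open set.\<close>

lemma strong_maximum_principle:
  assumes e: "norm e = 1" and l: "0 < l" "l < 1"
    and nonneg: "\<And>y. l < y \<bullet> e \<Longrightarrow> 0 \<le> gap e l y"
    and x: "x \<in> cball 0 1" "l < x \<bullet> e"
  shows "0 < gap e l x"
proof (cases "x \<in> ball 0 1")
  case False
  thus ?thesis
    using u_pos[OF reflect_in_ball[OF e l(1) x(2,1)]] u_zero[of x] by (simp add: gap_def)
next
  case xb: True
  show ?thesis
  proof (rule ccontr)
    assume "\<not> 0 < gap e l x"
    hence gap0: "gap e l x = 0" using nonneg[OF x(2)] by simp
    define E where "E = {y. l < y \<bullet> e} \<inter> {y. 1 < norm y} \<inter> {y. norm (reflect e l y) < 1}"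
    let ?D = "\<lambda>y. (gap e l y - gap e l x) * (J (x - y) - J (x - reflect e l y))"
    obtain B where B: "\<And>e l x. \<bar>gap e l x\<bar> \<le> B" using gap_bounded by blast
    have "open E" unfolding E_def
      by (intro open_Int open_Collect_less continuous_intros)
    hence [measurable]: "E \<in> sets borel" by simp
    \<comment> \<open>The mirror image of this point is \<open>(l - 1) e\<close>, which lies in the ball since \<open>0 < l < 1\<close>.\<close>
    have "(1 + l) *\<^sub>R e \<in> E"
    proof -
      have "e \<bullet> e = 1" using e by (simp flip: power2_norm_eq_inner)
      moreover have "reflect e l ((1 + l) *\<^sub>R e) = (l - 1) *\<^sub>R e"
        using reflect_axis[OF e, of l "1 + l"] by simp
      ultimately show ?thesis using l e by (simp add: E_def)
    qed
    hence "E \<noteq> {}" by blast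
    hence "E \<notin> null_sets lborel"
      using open_not_negligible[OF \<open>open E\<close>]
      by (auto simp: negligible_iff_null_sets null_sets_completionI)
    have D_pos: "0 < ?D y" if "y \<in> E" for y
    proof (rule mult_pos_pos)
      have "u y = 0" using that by (intro u_zero) (simp add: E_def)
      moreover have "0 < u (reflect e l y)" using that by (intro u_pos) (simp add: E_def)
      ultimately show "0 < gap e l y - gap e l x" by (simp add: gap0 gap_def[of e l y])
      have "x \<noteq> y" using that xb by (auto simp: E_def)
      thus "0 < J (x - y) - J (x - reflect e l y)"
        using norm_less_reflect[OF e x(2), of y] that J_less[of "x - y" "x - reflect e l y"]
        by (simp add: E_def)
    qed
    have "reflect e l x \<in> ball 0 1" using reflect_in_ball[OF e l(1) x(2,1)] .
    then obtain I where pv: "has_pv_integral (\<lambda>y. (gap e l x - gap e l y) * J (x - y)) I x"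
      and I: "A * I + b * gap e l x = f (u (reflect e l x)) - f (u x)"
      using gap_equation[OF e xb] by blast
    have "u (reflect e l x) = u x" using gap0 by (simp add: gap_def)
    hence I0: "I = 0" using I gap0 A_pos by simp
    have off: "E \<inter> ball x (1 - norm x) = {}"
    proof -
      have "norm y < 1" if "y \<in> ball x (1 - norm x)" for y
        using that norm_triangle_sub[of y x] by (simp add: dist_norm norm_minus_commute)
      thus ?thesis by (fastforce simp: E_def)
    qed
    have min: "gap e l x \<le> gap e l y" if "l < y \<bullet> e" for y using nonneg[OF that] gap0 by simp
    have "E \<subseteq> {y. l < y \<bullet> e}" "0 < 1 - norm x" using xb by (auto simp: E_def)
    note pvle = principal_value_le[OF e gap_borel B gap_reflect[OF e] x(2) min pv _ this off]
    have int: "integrable lborel (\<lambda>y. indicator E y *\<^sub>R ?D y)"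
      using pvle(1) by (simp add: set_integrable_def)
    have nn: "0 \<le> indicator E y *\<^sub>R ?D y" for y
      using D_pos[of y] by (cases "y \<in> E") auto
    have "(\<integral>y. indicator E y *\<^sub>R ?D y \<partial>lborel) \<le> 0"
      using pvle(2) by (simp add: gap0 I0 set_lebesgue_integral_def)
    hence "(\<integral>y. indicator E y *\<^sub>R ?D y \<partial>lborel) = 0"
      using Bochner_Integration.integral_nonneg[of lborel "\<lambda>y. indicator E y *\<^sub>R ?D y"] nn
      by (intro antisym) auto
    hence "AE y in lborel. indicator E y *\<^sub>R ?D y = 0"
      using integral_nonneg_eq_0_iff_AE[OF int] nn by simp
    hence "AE y in lborel. y \<notin> E"
      by eventually_elim (use D_pos in \<open>force simp: indicator_def\<close>)
    hence "E \<in> null_sets lborel"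
      by (simp add: AE_iff_null_sets)
    thus False using \<open>E \<notin> null_sets lborel\<close> by blast
  qed
qed

text \<open>The gap is nonnegative off the ball and zero on the hyperplane, so its infimum over the
half-space, if negative, is attained in a compact set and at an interior point of ball and
half-space.\<close>

lemma negative_minimum:
  assumes e: "norm e = 1" and y: "l < y \<bullet> e" "gap e l y < 0"
  obtains x where "x \<in> ball 0 1" "l < x \<bullet> e" "gap e l x < 0"
    "\<And>y. l < y \<bullet> e \<Longrightarrow> gap e l x \<le> gap e l y"
proof -
  let ?S = "cball 0 1 \<inter> {x. l \<le> x \<bullet> e}"
  have yb: "y \<in> ball 0 1" using gap_nonneg_outside[of y e l] y by force
  have "compact ?S"
    by (intro compact_Int_closed compact_cball closed_Collect_le continuous_intros)
  moreover have "y \<in> ?S" using y yb by simp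
  hence "?S \<noteq> {}" by blast
  moreover have "continuous_on ?S (gap e l)" by (intro continuous_intros)
  ultimately obtain x where x: "x \<in> ?S" "\<And>z. z \<in> ?S \<Longrightarrow> gap e l x \<le> gap e l z"
    using continuous_attains_inf[of ?S "gap e l"] by blast
  have neg: "gap e l x < 0" using x(2)[of y] y yb by simp
  have min: "gap e l x \<le> gap e l z" if "l < z \<bullet> e" for z
  proof (cases "z \<in> ball 0 1")
    case True
    thus ?thesis using x(2)[of z] that by simp
  next
    case False
    thus ?thesis using gap_nonneg_outside[OF False, of e l] neg by simp
  qed
  have "x \<in> ball 0 1" using gap_nonneg_outside[of x e l] neg by force
  moreover have "x \<bullet> e \<noteq> l"
  proof
    assume "x \<bullet> e = l"
    hence "gap e l x = 0" by (simp add: gap_def reflect_def)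
    thus False using neg by simp
  qed
  ultimately show thesis using that[of x] x(1) neg min by auto
qed

text \<open>Let \<open>k\<close> be the supremum of the positions at which the gap takes a negative value. At every such
position a negative minimum lies at distance at least \<open>\<delta>\<close> from the hyperplane. The pairs
of a position and a point of the closed ball with this distance and nonpositive gap form a
compact set, so its projection contains the limit position \<open>k\<close> too. This yields a point with
nonpositive gap at position \<open>k\<close>, and also \<open>k \<le> 1 - \<delta>\<close>, so the same estimate starts the
procedure near \<open>1\<close>. On the other hand a negative gap persists under small increases of the position, so
at \<open>k\<close> itself the gap is nonnegative, hence positive by the strong maximum principle.\<close>

lemma gap_nonneg:
  assumes e: "norm e = 1" and l: "0 < l" "l < 1" and x: "l < x \<bullet> e"
  shows "0 \<le> gap e l x"
proof (rule ccontr)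
  assume "\<not> 0 \<le> gap e l x"
  define Bad where "Bad = {k. 0 < k \<and> k < 1 \<and> (\<exists>y. k < y \<bullet> e \<and> gap e k y < 0)}"
  have "l \<in> Bad" using \<open>\<not> 0 \<le> gap e l x\<close> l x by (auto simp: Bad_def not_le)
  obtain \<delta> where \<delta>: "0 < \<delta>"
    "\<And>e l x. norm e = 1 \<Longrightarrow> 0 < l \<Longrightarrow> l < x \<bullet> e \<Longrightarrow> x \<in> ball 0 1 \<Longrightarrow> gap e l x < 0 \<Longrightarrow>
       (\<And>y. l < y \<bullet> e \<Longrightarrow> gap e l x \<le> gap e l y) \<Longrightarrow> \<delta> \<le> x \<bullet> e - l"
    using narrow_region by blast
  define K where "K = ({0..1} \<times> cball 0 1)
    \<inter> ({p :: real \<times> 'a. \<delta> \<le> snd p \<bullet> e - fst p} \<inter> {p. gap e (fst p) (snd p) \<le> 0})"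
  have "compact K" unfolding K_def
    by (intro compact_Int_closed compact_Times compact_cball compact_Icc closed_Int
        closed_Collect_le continuous_intros)
  hence "closed (fst ` K)"
    by (intro compact_imp_closed compact_continuous_image continuous_intros)
  have "Bad \<subseteq> fst ` K"
  proof
    fix k assume "k \<in> Bad"
    then obtain y where k: "0 < k" "k < 1" and y: "k < y \<bullet> e" "gap e k y < 0"
      by (auto simp: Bad_def)
    obtain z where z: "z \<in> ball 0 1" "k < z \<bullet> e" "gap e k z < 0"
      "\<And>y. k < y \<bullet> e \<Longrightarrow> gap e k z \<le> gap e k y"
      using negative_minimum[OF e y] by blast
    have "\<delta> \<le> z \<bullet> e - k" using \<delta>(2)[OF e k(1) z(2,1,3)] z(4) by blast
    hence "(k, z) \<in> K" using k z by (simp add: K_def)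
    thus "k \<in> fst ` K" by force
  qed
  define k where "k = Sup Bad"
  have bdd: "bdd_above Bad" by (auto simp: Bad_def intro!: bdd_aboveI[of _ 1])
  have "k \<in> closure Bad" unfolding k_def using \<open>l \<in> Bad\<close> bdd by (intro closure_contains_Sup) auto
  hence "k \<in> fst ` K" using closure_minimal[OF \<open>Bad \<subseteq> fst ` K\<close> \<open>closed (fst ` K)\<close>] by blast
  then obtain z where z: "z \<in> cball 0 1" "\<delta> \<le> z \<bullet> e - k" "gap e k z \<le> 0"
    by (auto simp: K_def)
  have "l \<le> k" unfolding k_def using \<open>l \<in> Bad\<close> bdd by (rule cSup_upper)
  hence "0 < k" using l by simp
  have "k < 1" using z inner_le_norm_unit[OF e, of z] \<delta>(1) by simp
  have "k \<notin> Bad"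
  proof
    assume "k \<in> Bad"
    then obtain y where y: "k < y \<bullet> e" "gap e k y < 0" by (auto simp: Bad_def)
    let ?U = "{k. 0 < k} \<inter> {k. k < 1} \<inter> {k. k < y \<bullet> e} \<inter> {k. gap e k y < 0}"
    have "open ?U" by (intro open_Int open_Collect_less continuous_intros)
    moreover have "k \<in> ?U" using y \<open>0 < k\<close> \<open>k < 1\<close> by simp
    ultimately obtain \<eta> where \<eta>: "0 < \<eta>" "ball k \<eta> \<subseteq> ?U" using openE by blast
    have "k + \<eta> / 2 \<in> ball k \<eta>" using \<eta> by (simp add: dist_real_def)
    hence "k + \<eta> / 2 \<in> ?U" using \<eta> by blast
    hence "k + \<eta> / 2 \<in> Bad" by (auto simp: Bad_def)
    hence "k + \<eta> / 2 \<le> k" unfolding k_def[symmetric] using bdd cSup_upper k_def by metis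
    thus False using \<eta> by simp
  qed
  hence "0 \<le> gap e k y" if "k < y \<bullet> e" for y
    using that \<open>0 < k\<close> \<open>k < 1\<close> by (force simp: Bad_def)
  hence "0 < gap e k z"
    using z \<delta>(1) \<open>0 < k\<close> \<open>k < 1\<close> by (intro strong_maximum_principle[OF e]) auto
  thus False using z by simp
qed

text \<open>Two points of equal norm are mirror images in a hyperplane through the origin. Nonnegativity of
the gap passes to this hyperplane as the limit of the positions \<open>l > 0\<close>.\<close>

lemma u_le_of_norm_eq:
  assumes "norm x = norm y"
  shows "u x \<le> u y"
proof (cases "x = y")
  case False
  define e where "e = (x - y) /\<^sub>R norm (x - y)"
  have n: "0 < norm (x - y)" using False by simp
  have e: "norm e = 1" using n by (simp add: e_def)
  have half: "x \<bullet> (x - y) = (norm (x - y))\<^sup>2 / 2"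
  proof -
    have "x \<bullet> x = y \<bullet> y" using assms by (simp flip: power2_norm_eq_inner)
    thus ?thesis by (simp add: power2_norm_eq_inner inner_diff_left inner_diff_right inner_commute)
  qed
  have "x \<bullet> e = (x \<bullet> (x - y)) / norm (x - y)"
    unfolding e_def by (simp only: inner_scaleR_right divide_inverse mult.commute)
  hence xe: "x \<bullet> e = norm (x - y) / 2"
    using n by (simp add: half power2_eq_square)
  have "reflect e 0 x = y"
    using n by (simp add: reflect_def xe) (simp add: e_def)
  have "continuous_on UNIV (\<lambda>l. gap e l x)" by (intro continuous_intros)
  hence "((\<lambda>l. gap e l x) \<longlongrightarrow> gap e 0 x) (at_right 0)"
    by (metis UNIV_I continuous_on_def filterlim_at_split tendsto_within_subset subset_UNIV)
  moreover have "\<forall>\<^sub>F l in at_right 0. 0 \<le> gap e l x"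
    using eventually_at_right_real[of 0 "min 1 (x \<bullet> e)"] xe n
    by (auto elim!: eventually_mono intro!: gap_nonneg[OF e])
  ultimately have "0 \<le> gap e 0 x" by (intro tendsto_lowerbound) auto
  thus ?thesis using \<open>reflect e 0 x = y\<close> by (simp add: gap_def)
qed simp

theorem radially_symmetric_decreasing:
  "\<exists>\<phi> :: real \<Rightarrow> real. (\<forall>x. u x = \<phi> (norm x)) \<and> strict_antimono_on {0..1} \<phi>"
proof -
  obtain e :: 'a where "e \<in> Basis" using nonempty_Basis by blast
  hence e: "norm e = 1" "e \<bullet> e = 1" by (auto simp: inner_Basis)
  define \<phi> where "\<phi> r = u (r *\<^sub>R e)" for r
  have "u x = \<phi> (norm x)" for x
    unfolding \<phi>_def using e by (intro antisym u_le_of_norm_eq) auto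
  moreover have "strict_antimono_on {0..1} \<phi>"
  proof (rule monotone_onI)
    fix r t :: real
    assume rt: "r \<in> {0..1}" "t \<in> {0..1}" "r < t"
    \<comment> \<open>The mirror at the midpoint exchanges \<open>r e\<close> and \<open>t e\<close>.\<close>
    define l where "l = (r + t) / 2"
    have l: "0 < l" "l < 1" "l < t" using rt by (auto simp: l_def)
    have "reflect e l (t *\<^sub>R e) = r *\<^sub>R e"
    proof -
      have "2 * l - t = r" by (simp add: l_def field_simps)
      thus ?thesis using reflect_axis[OF e(1), of l t] by simp
    qed
    moreover have "0 < gap e l (t *\<^sub>R e)"
      using rt l e by (intro strong_maximum_principle[OF e(1)] gap_nonneg[OF e(1)]) auto
    ultimately show "\<phi> t < \<phi> r" by (simp add: gap_def \<phi>_def)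
  qed
  ultimately show ?thesis by blast
qed

end

theorem theorem2p21:
  fixes m s :: real
    and f :: "real \<Rightarrow> real"
    and u :: "'a::euclidean_space \<Rightarrow> real"
  assumes "0 < s" "s < 1"
    and "0 < m"
    and "\<exists>L. L-lipschitz_on UNIV f"
    and "C11_loc_on (ball 0 1) u"
    and "continuous_on (cball 0 1) u"
    and "\<And>x. x \<in> ball 0 1 \<Longrightarrow> has_frac_op m s u x (f (u x))"
    and "\<And>x. x \<in> ball 0 1 \<Longrightarrow> u x > 0"
    and "\<And>x. x \<notin> ball 0 1 \<Longrightarrow> u x = 0"
  shows "\<exists>\<phi> :: real \<Rightarrow> real. (\<forall>x. u x = \<phi> (norm x)) \<and> strict_antimono_on {0..1} \<phi>"
proof -
  note s = assms(1,2) and m = assms(3) and eq = assms(7) and pos = assms(8) and zero = assms(9)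
  obtain L where L: "L-lipschitz_on UNIV f" using assms(4) by blast
  define \<alpha> where "\<alpha> = real DIM('a) / 2 + s"
  have \<alpha>: "0 < \<alpha>" using s by (simp add: \<alpha>_def)
  define J :: "'a \<Rightarrow> real" where "J = bessel_kernel m \<alpha>"
  have eqJ: "\<exists>I. has_pv_integral (\<lambda>y. (u x - u y) * J (x - y)) I x \<and>
      c_Ns DIM('a) s * m powr \<alpha> * I + m powr (2 * s) * u x = f (u x)" if "x \<in> ball 0 1" for x
    using eq[OF that] unfolding has_frac_op_def Let_def J_def bessel_kernel_def \<alpha>_def by (auto simp: eq_commute)
  \<comment> \<open>Off the ball the integrand at the origin is \<open>u 0\<close> times the kernel, so the equation at the
    origin already contains the integrability of the kernel at infinity.\<close>
  have J_int: "set_integrable lborel (- ball 0 1) J"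
  proof -
    have "set_integrable lborel (- ball 0 1) (\<lambda>y. (u 0 - u y) * J (0 - y))"
      using eqJ[of 0] by (auto simp: has_pv_integral_def)
    also have "?this \<longleftrightarrow> set_integrable lborel (- ball 0 1) (\<lambda>y. u 0 * J y)"
      by (intro set_integrable_cong) (auto simp: zero J_def bessel_kernel_def)
    finally show ?thesis using pos[of 0] by simp
  qed
  have A: "0 < c_Ns DIM('a) s * m powr \<alpha>"
  proof -
    have "0 < Gamma (2 - s)" using s by (intro Gamma_real_pos) auto
    thus ?thesis using s m by (simp add: c_Ns_def)
  qed
  have cont: "continuous_on UNIV u"
  proof -
    have "continuous_on (- ball 0 1) u \<longleftrightarrow> continuous_on (- ball (0::'a) 1) (\<lambda>x. 0 :: real)"
      by (intro continuous_on_cong) (auto simp: zero)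
    hence "continuous_on (cball 0 1 \<union> - ball 0 1) u"
      using assms(6) by (intro continuous_on_closed_Un) auto
    moreover have "cball 0 1 \<union> - ball 0 1 = (UNIV :: 'a set)" by auto
    ultimately show ?thesis by simp
  qed
  interpret radial_dirichlet_problem J "exp (- 1 - \<alpha>) / 2 * m powr (- \<alpha>)"
    "min 1 (exp (- 1) / m)" u f "c_Ns DIM('a) s * m powr \<alpha>" "m powr (2 * s)" L
  proof
    show "J \<in> borel_measurable borel" by (simp add: J_def)
    show "0 < J x" if "x \<noteq> 0" for x
      unfolding J_def using m \<alpha> that by (intro bessel_kernel_pos) auto
    show "J y < J x" if "x \<noteq> 0" "norm x < norm y" for x y
      unfolding J_def using m \<alpha> that by (rule bessel_kernel_less)
    show "J x = J y" if "norm x = norm y" for x y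
      using that by (simp add: J_def bessel_kernel_def)
    show "exp (- 1 - \<alpha>) / 2 * m powr (- \<alpha>) / norm x ^ DIM('a) \<le> J x"
      if "x \<noteq> 0" "norm x \<le> min 1 (exp (- 1) / m)" for x
      unfolding J_def \<alpha>_def using s by (intro bessel_kernel_lower[OF m _ that]) simp
    show "0 < exp (- 1 - \<alpha>) / 2 * m powr (- \<alpha>)" "0 < min 1 (exp (- 1) / m)"
      using m by simp_all
    show "0 \<le> m powr (2 * s)" by simp
  qed (fact J_int A L cont eqJ pos zero)+
  show ?thesis by (rule radially_symmetric_decreasing)
qed

end
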